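(* There exist a finitely generated residually finite group $\Gamma$ and a Noetherian action $\beta$ of $\Gamma$ on a compact metrizable abelian group $Y$ such that the set of $\beta$-periodic points is not dense in $Y$.
   Context: An algebraic $\Gamma$-action $(Y,\beta)$ of a countable (discrete) group $\Gamma$ is an action $\beta$ of $\Gamma$ on a compact metrizable abelian group $Y$ by continuous automorphisms. The dual action of $\Gamma$ by automorphisms of the Pontryagin dual $\widehat{Y}$ makes $\widehat{Y}$ a module over the integral group ring $\mathbb{Z}[\Gamma]$. The action $\beta$ is Noetherian if $\widehat{Y}$ is a Noetherian $\mathbb{Z}[\Gamma]$-module; equivalently, every decreasing sequence $Y = Y_0\supset Y_1\supset Y_2\supset\cdots$ of closed $\Gamma$-invariant subgroups stabilizes. A point $y\in Y$ is $\beta$-periodic if its $\Gamma$-orbit is finite. *)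

theory Defs
  imports
    "HOL-Analysis.Analysis"
    "HOL-Algebra.Group_Action"
    "HOL-Algebra.Generated_Groups"
    "HOL-Algebra.Module"
begin

section \<open>Groups\<close>

definition finitely_generated_group :: "('a, 'b) monoid_scheme \<Rightarrow> bool" where
  "finitely_generated_group G \<longleftrightarrow>
     group G \<and> (\<exists>S \<subseteq> carrier G. finite S \<and> generate G S = carrier G)"

definition residually_finite_group :: "('a, 'b) monoid_scheme \<Rightarrow> bool" where
  "residually_finite_group G \<longleftrightarrow>
     group G \<and>
     (\<forall>g \<in> carrier G - {\<one>\<^bsub>G\<^esub>}. \<exists>N. N \<lhd> G \<and> finite (rcosets\<^bsub>G\<^esub> N) \<and> g \<notin> N)"

definition compact_metrizable_abelian_group ::
  "('y, 'b) monoid_scheme \<Rightarrow> 'y topology \<Rightarrow> bool" where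
  "compact_metrizable_abelian_group Y T \<longleftrightarrow>
     comm_group Y \<and> topspace T = carrier Y \<and>
     continuous_map (prod_topology T T) T (\<lambda>(x, y). x \<otimes>\<^bsub>Y\<^esub> y) \<and>
     continuous_map T T (\<lambda>x. inv\<^bsub>Y\<^esub> x) \<and>
     compact_space T \<and> metrizable_space T"


section \<open>Algebraic actions\<close>

text \<open>Each \<^term>\<open>\<beta> g\<close> is a bijection of \<^term>\<open>carrier Y\<close> by the library notion of a group action;
  continuity of its inverse is continuity of the map for the inverse group element.\<close>

definition algebraic_action ::
  "('g, 'a) monoid_scheme \<Rightarrow> ('y, 'b) monoid_scheme \<Rightarrow> 'y topology \<Rightarrow> ('g \<Rightarrow> 'y \<Rightarrow> 'y) \<Rightarrow> bool" where
  "algebraic_action G Y T \<beta> \<longleftrightarrow>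
     group G \<and> countable (carrier G) \<and>
     compact_metrizable_abelian_group Y T \<and>
     group_action G (carrier Y) \<beta> \<and>
     (\<forall>g \<in> carrier G. \<beta> g \<in> hom Y Y \<and> continuous_map T T (\<beta> g))"

definition periodic_points ::
  "('g, 'a) monoid_scheme \<Rightarrow> ('y, 'b) monoid_scheme \<Rightarrow> ('g \<Rightarrow> 'y \<Rightarrow> 'y) \<Rightarrow> 'y set" where
  "periodic_points G Y \<beta> = {y \<in> carrier Y. finite (orbit G \<beta> y)}"


section \<open>The integral group ring and the dual module\<close>

definition group_ring_supp :: "('g, 'a) monoid_scheme \<Rightarrow> ('g \<Rightarrow> int) \<Rightarrow> 'g set" where
  "group_ring_supp G a = {g \<in> carrier G. a g \<noteq> 0}"

text \<open>An element of the group ring is a finitely supported function on \<^term>\<open>carrier G\<close>,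
  extended by \<^term>\<open>0\<close> to the whole type.\<close>

definition int_group_ring :: "('g, 'a) monoid_scheme \<Rightarrow> ('g \<Rightarrow> int) ring" where
  "int_group_ring G =
     \<lparr>carrier = {a. (\<forall>g. g \<notin> carrier G \<longrightarrow> a g = 0) \<and> finite (group_ring_supp G a)},
      mult = (\<lambda>a b g. if g \<in> carrier G
                      then \<Sum>h \<in> group_ring_supp G a. a h * b (inv\<^bsub>G\<^esub> h \<otimes>\<^bsub>G\<^esub> g) else 0),
      one = (\<lambda>g. if g = \<one>\<^bsub>G\<^esub> then 1 else 0),
      zero = (\<lambda>g. 0),
      add = (\<lambda>a b g. a g + b g)\<rparr>"

definition circle_group :: "complex monoid" where
  "circle_group = \<lparr>carrier = sphere 0 1, mult = (*), one = 1\<rparr>"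

text \<open>Characters are made extensional so that the dual contains each of them only once.\<close>

definition characters :: "('y, 'b) monoid_scheme \<Rightarrow> 'y topology \<Rightarrow> ('y \<Rightarrow> complex) set" where
  "characters Y T =
     {\<phi> \<in> extensional (carrier Y). \<phi> \<in> hom Y circle_group \<and> continuous_map T euclidean \<phi>}"

text \<open>The Pontryagin dual as a left module over the integral group ring.  The dual action is
  \<open>(g \<phi>)(y) = \<phi>(\<beta>(g\<^sup>-\<^sup>1) y)\<close>; since the addition of characters is the
  pointwise product, \<open>\<Sum> a\<^sub>g g\<close> sends \<open>\<phi>\<close> to the product of the powers \<open>(g \<phi>)\<^bsup>a\<^sub>g\<^esup>\<close>.
  The fields \<open>mult\<close> and \<open>one\<close> of the module record play no role.\<close>

definition dual_module ::
  "('g, 'a) monoid_scheme \<Rightarrow> ('y, 'b) monoid_scheme \<Rightarrow> 'y topology \<Rightarrow> ('g \<Rightarrow> 'y \<Rightarrow> 'y)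
     \<Rightarrow> ('g \<Rightarrow> int, 'y \<Rightarrow> complex) module" where
  "dual_module G Y T \<beta> =
     \<lparr>carrier = characters Y T,
      mult = undefined,
      one = undefined,
      zero = (\<lambda>y \<in> carrier Y. 1),
      add = (\<lambda>\<phi> \<psi>. \<lambda>y \<in> carrier Y. \<phi> y * \<psi> y),
      smult = (\<lambda>a \<phi>. \<lambda>y \<in> carrier Y.
                 \<Prod>g \<in> group_ring_supp G a. \<phi> (\<beta> (inv\<^bsub>G\<^esub> g) y) powi a g)\<rparr>"

text \<open>The library locale \<^locale>\<open>module\<close> requires a commutative ring of scalars, but
  \<^const>\<open>submodule\<close> does not, so it serves for left modules over the group ring.\<close>

definition noetherian_module :: "('r, 'a) ring_scheme \<Rightarrow> ('r, 'm, 'b) module_scheme \<Rightarrow> bool" where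
  "noetherian_module R M \<longleftrightarrow>
     (\<forall>H. submodule H R M \<longrightarrow>
        (\<exists>A \<subseteq> H. finite A \<and> H = \<Inter> {K. submodule K R M \<and> A \<subseteq> K}))"

definition noetherian_action ::
  "('g, 'a) monoid_scheme \<Rightarrow> ('y, 'b) monoid_scheme \<Rightarrow> 'y topology \<Rightarrow> ('g \<Rightarrow> 'y \<Rightarrow> 'y) \<Rightarrow> bool" where
  "noetherian_action G Y T \<beta> \<longleftrightarrow>
     algebraic_action G Y T \<beta> \<and> noetherian_module (int_group_ring G) (dual_module G Y T \<beta>)"

end

(* The lamplighter group Z/2 wr Z acts on the product of copies of the group of cube roots of unity
   indexed by Z: the generator of Z shifts the coordinates, and the lamp at i inverts the i-th
   coordinate. On the dual, a direct sum of copies of Z/3, the difference of a character and its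
   translate under the lamp at i depends on the i-th coordinate only. Hence a nonzero submodule
   contains a coordinate character, and by shifting all of them: the dual is simple, in particular
   Noetherian. A periodic point has a shift-periodic set of nontrivial coordinates; if that set is
   nonempty, it is infinite, and the lamps at its elements move the point to infinitely many others.
   So the identity is the only periodic point. *)

theory Submission
  imports Defs
begin

section \<open>The lamplighter group\<close>

text \<open>The fibres of \<open>F\<close> are the classes of a congruence, and \<open>N\<close> is
  the class of the identity. Elements of one fibre share a coset, so the index is at most the number
  of values of \<open>F\<close>. A finite quotient is thus obtained without constructing its group
  structure.\<close>

lemma finite_quotient_normal:
  assumes G: "group G"
    and fin: "finite (F ` carrier G)"
    and cong: "\<And>x x' y y'. \<lbrakk>x \<in> carrier G; x' \<in> carrier G; y \<in> carrier G; y' \<in> carrier G;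
                 F x = F x'; F y = F y'\<rbrakk> \<Longrightarrow> F (x \<otimes>\<^bsub>G\<^esub> y) = F (x' \<otimes>\<^bsub>G\<^esub> y')"
  defines "N \<equiv> {x \<in> carrier G. F x = F \<one>\<^bsub>G\<^esub>}"
  shows "N \<lhd> G" and "finite (rcosets\<^bsub>G\<^esub> N)"
proof -
  interpret group G by (rule G)
  have sub: "subgroup N G"
  proof (rule subgroupI)
    show "N \<subseteq> carrier G" "N \<noteq> {}" unfolding N_def by auto
  next
    fix a assume a: "a \<in> N"
    then have "F (a \<otimes>\<^bsub>G\<^esub> inv\<^bsub>G\<^esub> a) = F (\<one>\<^bsub>G\<^esub> \<otimes>\<^bsub>G\<^esub> inv\<^bsub>G\<^esub> a)"
      unfolding N_def by (intro cong) auto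
    with a show "inv\<^bsub>G\<^esub> a \<in> N" unfolding N_def by simp
  next
    fix a b assume ab: "a \<in> N" "b \<in> N"
    then have "F (a \<otimes>\<^bsub>G\<^esub> b) = F (\<one>\<^bsub>G\<^esub> \<otimes>\<^bsub>G\<^esub> \<one>\<^bsub>G\<^esub>)"
      unfolding N_def by (intro cong) auto
    with ab show "a \<otimes>\<^bsub>G\<^esub> b \<in> N" unfolding N_def by simp
  qed
  have "x \<otimes>\<^bsub>G\<^esub> h \<otimes>\<^bsub>G\<^esub> inv\<^bsub>G\<^esub> x \<in> N" if x: "x \<in> carrier G" and h: "h \<in> N" for x h
  proof -
    have hc: "h \<in> carrier G" "F h = F \<one>\<^bsub>G\<^esub>" using h by (auto simp: N_def)
    have "F (x \<otimes>\<^bsub>G\<^esub> h) = F (x \<otimes>\<^bsub>G\<^esub> \<one>\<^bsub>G\<^esub>)"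
      using x hc by (intro cong) auto
    then have "F (x \<otimes>\<^bsub>G\<^esub> h \<otimes>\<^bsub>G\<^esub> inv\<^bsub>G\<^esub> x) = F (x \<otimes>\<^bsub>G\<^esub> inv\<^bsub>G\<^esub> x)"
      using x hc by (intro cong) auto
    with x hc show ?thesis by (simp add: N_def)
  qed
  with sub show "N \<lhd> G" by (simp add: normal_inv_iff)
  have coset: "N #>\<^bsub>G\<^esub> x = N #>\<^bsub>G\<^esub> y"
    if xy: "x \<in> carrier G" "y \<in> carrier G" "F x = F y" for x y
  proof -
    have "F (x \<otimes>\<^bsub>G\<^esub> inv\<^bsub>G\<^esub> y) = F (y \<otimes>\<^bsub>G\<^esub> inv\<^bsub>G\<^esub> y)"
      using xy by (intro cong) auto
    then have "x \<otimes>\<^bsub>G\<^esub> inv\<^bsub>G\<^esub> y \<in> N" using xy by (simp add: N_def)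
    then have "x \<otimes>\<^bsub>G\<^esub> inv\<^bsub>G\<^esub> y \<otimes>\<^bsub>G\<^esub> y \<in> N #>\<^bsub>G\<^esub> y"
      using xy sub by (intro rcosI) (auto simp: subgroup.subset)
    then have "x \<in> N #>\<^bsub>G\<^esub> y" using xy by (simp add: m_assoc)
    then show ?thesis using repr_independence sub xy by metis
  qed
  \<comment> \<open>One representative per value of \<open>F\<close>, so that the finitely many
    values index all cosets.\<close>
  define r where "r v = (SOME x. x \<in> carrier G \<and> F x = v)" for v
  have "rcosets\<^bsub>G\<^esub> N \<subseteq> (\<lambda>v. N #>\<^bsub>G\<^esub> r v) ` F ` carrier G"
  proof
    fix R assume "R \<in> rcosets\<^bsub>G\<^esub> N"
    then obtain x where x: "x \<in> carrier G" "R = N #>\<^bsub>G\<^esub> x" by (auto simp: RCOSETS_def)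
    have "r (F x) \<in> carrier G \<and> F (r (F x)) = F x"
      unfolding r_def by (rule someI[of _ x]) (use x in auto)
    then have "R = N #>\<^bsub>G\<^esub> r (F x)" using coset x by metis
    with x show "R \<in> (\<lambda>v. N #>\<^bsub>G\<^esub> r v) ` F ` carrier G" by blast
  qed
  with fin show "finite (rcosets\<^bsub>G\<^esub> N)" using finite_surj by blast
qed

text \<open>A pair \<open>(k, A)\<close> stands for the lamplighter at position \<open>k\<close> with the lamps in \<open>A\<close> lit.\<close>

definition lamp_mult :: "int \<times> int set \<Rightarrow> int \<times> int set \<Rightarrow> int \<times> int set" where
  "lamp_mult x y = (fst x + fst y, {i. (i \<in> snd x) \<noteq> (i - fst x \<in> snd y)})"

text \<open>Group elements must have type \<open>nat => nat\<close>. The value at 0 holds the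
  position, and the later values are the indicator function of the lit lamps.\<close>

definition lamp_code :: "int \<times> int set \<Rightarrow> nat \<Rightarrow> nat" where
  "lamp_code x = (\<lambda>n. case n of 0 \<Rightarrow> int_encode (fst x)
                       | Suc m \<Rightarrow> if int_decode m \<in> snd x then 1 else 0)"

definition lamp_decode :: "(nat \<Rightarrow> nat) \<Rightarrow> int \<times> int set" where
  "lamp_decode f = (int_decode (f 0), {i. f (Suc (int_encode i)) = 1})"

lemma lamp_decode_code [simp]: "lamp_decode (lamp_code x) = x"
  by (simp add: lamp_decode_def lamp_code_def prod_eq_iff)

lemma lamp_code_eq_iff [simp]: "lamp_code x = lamp_code y \<longleftrightarrow> x = y"
  by (metis lamp_decode_code)

definition lamplighter :: "(nat \<Rightarrow> nat) monoid" where
  "lamplighter =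
     \<lparr>carrier = lamp_code ` {x. finite (snd x)},
      mult = (\<lambda>f g. lamp_code (lamp_mult (lamp_decode f) (lamp_decode g))),
      one = lamp_code (0, {})\<rparr>"

lemma lamp_carrier: "carrier lamplighter = lamp_code ` {x. finite (snd x)}"
  and lamp_one: "\<one>\<^bsub>lamplighter\<^esub> = lamp_code (0, {})"
  and lamp_times: "lamp_code x \<otimes>\<^bsub>lamplighter\<^esub> lamp_code y = lamp_code (lamp_mult x y)"
  by (simp_all add: lamplighter_def)

lemma lamp_code_in_carrier [simp]: "lamp_code (k, A) \<in> carrier lamplighter \<longleftrightarrow> finite A"
  by (auto simp: lamp_carrier)

lemma lamp_carrierE:
  assumes "g \<in> carrier lamplighter"
  obtains k A where "g = lamp_code (k, A)" "finite A"
  using assms by (auto simp: lamp_carrier)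

lemma finite_shift: "finite A \<Longrightarrow> finite {i. i - k \<in> A}" for k :: int
  by (rule finite_subset[of _ "(\<lambda>j. j + k) ` A"]) (auto intro: image_eqI[of _ _ "_ - k"])

text \<open>The lamp set of a product, in the form to which the simplifier rewrites the
  \<open>\<noteq>\<close> between propositions in \<open>lamp_mult\<close>.\<close>

lemma finite_lamp_mult: "finite A \<Longrightarrow> finite B \<Longrightarrow> finite {i. (i \<in> A) = (i - k \<notin> B)}" for k :: int
  by (rule finite_subset[of _ "A \<union> {i. i - k \<in> B}"]) (auto simp: finite_shift)

lemma group_lamplighter: "group lamplighter"
proof (rule groupI)
  fix f g assume "f \<in> carrier lamplighter" "g \<in> carrier lamplighter"
  then show "f \<otimes>\<^bsub>lamplighter\<^esub> g \<in> carrier lamplighter"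
    by (elim lamp_carrierE) (simp add: lamp_times lamp_mult_def finite_lamp_mult)
next
  fix f g h assume "f \<in> carrier lamplighter" "g \<in> carrier lamplighter" "h \<in> carrier lamplighter"
  then show "f \<otimes>\<^bsub>lamplighter\<^esub> g \<otimes>\<^bsub>lamplighter\<^esub> h = f \<otimes>\<^bsub>lamplighter\<^esub> (g \<otimes>\<^bsub>lamplighter\<^esub> h)"
    by (elim lamp_carrierE) (auto simp: lamp_times lamp_mult_def algebra_simps)
next
  fix f assume "f \<in> carrier lamplighter"
  then obtain k A where f: "f = lamp_code (k, A)" "finite A" by (rule lamp_carrierE)
  \<comment> \<open>In the product the lamps of \<open>f\<close> are shifted by \<open>- k\<close>.
    The witness has exactly these lamps lit, so all of them cancel.\<close>
  show "\<exists>g\<in>carrier lamplighter. g \<otimes>\<^bsub>lamplighter\<^esub> f = \<one>\<^bsub>lamplighter\<^esub>"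
    by (rule bexI[of _ "lamp_code (- k, {i. i - (- k) \<in> A})"])
      (use f finite_shift[of A "- k"] in \<open>auto simp: lamp_times lamp_one lamp_mult_def\<close>)
qed (auto simp: lamp_one lamp_times lamp_mult_def elim!: lamp_carrierE)

lemma lamp_inv:
  assumes "finite A"
  shows "inv\<^bsub>lamplighter\<^esub> (lamp_code (k, A)) = lamp_code (- k, {i. i + k \<in> A})"
proof -
  interpret group lamplighter by (rule group_lamplighter)
  show ?thesis
    by (rule inv_equality)
      (use assms finite_shift[of A "- k"] in \<open>auto simp: lamp_times lamp_one lamp_mult_def\<close>)
qed

lemma countable_lamplighter: "countable (carrier lamplighter)"
proof -
  have "{x :: int \<times> int set. finite (snd x)} = UNIV \<times> Collect finite" by auto
  then show ?thesis
    unfolding lamp_carrier by (simp add: countable_Collect_finite)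
qed

section \<open>Finite generation\<close>

text \<open>The generators are one step and the lamp at 0. Conjugation by \<open>j\<close> steps
  gives the lamp at \<open>j\<close>, products of lamps give every finite lamp set, and a final walk
  sets the position.\<close>

lemma finitely_generated_lamplighter: "finitely_generated_group lamplighter"
proof -
  interpret group lamplighter by (rule group_lamplighter)
  define S where "S = {lamp_code (1, {}), lamp_code (0, {0})}"
  have S: "S \<subseteq> carrier lamplighter" by (auto simp: S_def)
  define H where "H = generate lamplighter S"
  have sub: "subgroup H lamplighter" unfolding H_def by (rule generate_is_subgroup[OF S])
  have mult: "lamp_code (lamp_mult x y) \<in> H" if "lamp_code x \<in> H" "lamp_code y \<in> H" for x y
    using subgroup.m_closed[OF sub that] by (simp add: lamp_times)
  have s: "lamp_code (1, {}) \<in> H" and t: "lamp_code (0, {0}) \<in> H"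
    unfolding H_def S_def by (auto intro: generate.incl)
  have s': "lamp_code (- 1, {}) \<in> H"
    using subgroup.m_inv_closed[OF sub s] by (simp add: lamp_inv)
  have shift: "lamp_code (k, {}) \<in> H" for k
  proof (induction k rule: int_induct[where k = 0])
    case base
    show ?case using subgroup.one_closed[OF sub] by (simp add: lamp_one)
  next
    case (step1 i)
    show ?case using mult[OF step1(2) s] by (simp add: lamp_mult_def)
  next
    case (step2 i)
    show ?case using mult[OF step2(2) s'] by (simp add: lamp_mult_def)
  qed
  have lamp: "lamp_code (0, {j}) \<in> H" for j
  proof -
    have "lamp_mult (lamp_mult (j, {}) (0, {0})) (- j, {}) = (0, {j})"
      by (auto simp: lamp_mult_def)
    then show ?thesis using mult[OF mult[OF shift[of j] t] shift[of "- j"]] by simp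
  qed
  have lamps: "lamp_code (0, A) \<in> H" if "finite A" for A
    using that
  proof induction
    case empty
    show ?case by (rule shift)
  next
    case (insert j A)
    then have "lamp_mult (0, {j}) (0, A) = (0, insert j A)"
      by (auto simp: lamp_mult_def)
    then show ?case using mult[OF lamp[of j] insert.IH] by simp
  qed
  have "lamp_code (k, A) \<in> H" if "finite A" for k A
    using mult[OF lamps[OF that] shift[of k]] by (simp add: lamp_mult_def)
  then have "H = carrier lamplighter"
    using subgroup.subset[OF sub] by (auto elim: lamp_carrierE)
  moreover have "finite S" by (simp add: S_def)
  ultimately show ?thesis
    unfolding finitely_generated_group_def H_def using S group_lamplighter by blast
qed

text \<open>Reduction modulo \<open>n\<close>: the lamplighter walks on a cycle of length \<open>n\<close>, and the lamps whose
  positions become equal are added up in \<open>\<int>/2\<close>.\<close>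

definition lamp_fold :: "int \<Rightarrow> int \<times> int set \<Rightarrow> int \<times> int set" where
  "lamp_fold n x = (fst x mod n, {r \<in> {0..<n}. odd (card {i \<in> snd x. i mod n = r})})"

text \<open>Adding the two cardinalities counts the intersection twice, which does not affect
  parity. This makes counting lamps modulo 2 compatible with multiplication.\<close>

lemma odd_card_symdiff:
  assumes "finite A" "finite B"
  shows "odd (card {i. (i \<in> A) \<noteq> (i \<in> B)}) \<longleftrightarrow> odd (card A) \<noteq> odd (card B)"
proof -
  have "card {i. (i \<in> A) \<noteq> (i \<in> B)} = card ((A - B) \<union> (B - A))"
    by (rule arg_cong[of _ _ card]) auto
  also have "\<dots> = card (A - B) + card (B - A)"
    using assms by (intro card_Un_disjoint) auto
  finally have "card {i. (i \<in> A) \<noteq> (i \<in> B)} + 2 * card (A \<inter> B) = card A + card B"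
    using assms card_Int_Diff[of A B] card_Int_Diff[of B A] by (simp add: Int_commute)
  then show ?thesis by presburger
qed

text \<open>The point is that the right-hand side involves the factors only through their reductions
  modulo \<open>n\<close>, which is the congruence that \<open>finite_quotient_normal\<close> asks
  for.\<close>

lemma lamp_fold_mult:
  assumes n: "n > 0" and "finite A" "finite B"
  shows "lamp_fold n (lamp_mult (k, A) (l, B)) =
    ((k mod n + l mod n) mod n,
     {r \<in> {0..<n}. (r \<in> snd (lamp_fold n (k, A))) \<noteq> ((r - k mod n) mod n \<in> snd (lamp_fold n (l, B)))})"
proof -
  have "odd (card {i. ((i \<in> A) \<noteq> (i - k \<in> B)) \<and> i mod n = r}) \<longleftrightarrow>
      odd (card {i \<in> A. i mod n = r}) \<noteq> odd (card {j \<in> B. j mod n = (r - k mod n) mod n})"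
    if r: "0 \<le> r" "r < n" for r
  proof -
    \<comment> \<open>A lamp of the second factor at \<open>j\<close> ends up at
      \<open>j + k\<close>, so the residue \<open>r\<close> after the shift comes from the residue
      of \<open>r - k\<close>.\<close>
    have eq: "i mod n = r \<longleftrightarrow> (i - k) mod n = (r - k) mod n" for i
      using r mod_eq_dvd_iff[of i n r] mod_eq_dvd_iff[of "i - k" n "r - k"] by simp
    have "bij_betw (\<lambda>i. i - k) {i. i - k \<in> B \<and> i mod n = r} {j \<in> B. j mod n = (r - k mod n) mod n}"
      by (rule bij_betw_byWitness[where f' = "\<lambda>j. j + k"]) (auto simp: eq mod_diff_right_eq)
    then have card_eq: "card {i. i - k \<in> B \<and> i mod n = r} = card {j \<in> B. j mod n = (r - k mod n) mod n}"
      by (rule bij_betw_same_card)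
    have set_eq: "{i. ((i \<in> A) \<noteq> (i - k \<in> B)) \<and> i mod n = r} =
        {i. (i \<in> {i \<in> A. i mod n = r}) \<noteq> (i \<in> {i. i - k \<in> B \<and> i mod n = r})}"
      by auto
    have fin: "finite {i \<in> A. i mod n = r}" "finite {i. i - k \<in> B \<and> i mod n = r}"
      by (use assms in simp, rule finite_subset[OF _ finite_shift[of B k]]) (use assms in auto)
    show ?thesis
      by (simp only: set_eq odd_card_symdiff[OF fin] card_eq)
  qed
  then show ?thesis
    using n by (auto simp: lamp_fold_def lamp_mult_def mod_add_eq)
qed

text \<open>A nontrivial element survives on a suitable cycle: if its position is nonzero, one
  longer than the displacement; otherwise, one so long that no two lit lamps are identified.\<close>

lemma residually_finite_lamplighter: "residually_finite_group lamplighter"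
  unfolding residually_finite_group_def
proof (intro conjI ballI)
  show "group lamplighter" by (rule group_lamplighter)
  fix g assume g: "g \<in> carrier lamplighter - {\<one>\<^bsub>lamplighter\<^esub>}"
  then obtain k A where kA: "g = lamp_code (k, A)" "finite A" by (auto elim: lamp_carrierE)
  have "\<exists>n > 0. lamp_fold n (k, A) \<noteq> lamp_fold n (0, {})"
  proof (cases "k = 0")
    case False
    have "k mod (\<bar>k\<bar> + 1) \<noteq> 0"
      using False dvd_imp_le_int[of k "\<bar>k\<bar> + 1"] by (auto simp: mod_eq_0_iff_dvd)
    then show ?thesis by (intro exI[of _ "\<bar>k\<bar> + 1"]) (auto simp: lamp_fold_def)
  next
    case True
    with g kA obtain a where a: "a \<in> A" by (auto simp: lamp_one)
    obtain M where M: "\<And>i. i \<in> A \<Longrightarrow> \<bar>i\<bar> \<le> M"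
      using kA(2) by (metis Max_ge finite_imageI imageI)
    \<comment> \<open>Two positions in \<open>A\<close> differ by at most \<open>2 * M\<close>,
      hence are congruent modulo \<open>n\<close> only if equal. The residue class of
      \<open>a\<close> then contains a single lit lamp, an odd number.\<close>
    define n where "n = 2 * M + 1"
    have n: "n > 0" using M[OF a] by (simp add: n_def)
    have "i = a" if "i \<in> A" "i mod n = a mod n" for i
    proof -
      have "n dvd i - a" using that by (simp add: mod_eq_dvd_iff)
      moreover have "\<bar>i - a\<bar> < n" using M[OF a] M[OF that(1)] by (simp add: n_def)
      ultimately show ?thesis using dvd_imp_le_int[of "i - a" n] n by force
    qed
    then have "{i \<in> A. i mod n = a mod n} = {a}" using a by auto
    then have "a mod n \<in> snd (lamp_fold n (k, A))"
      using n by (simp add: lamp_fold_def)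
    moreover have "a mod n \<notin> snd (lamp_fold n (0, {}))" by (simp add: lamp_fold_def)
    ultimately show ?thesis using n by metis
  qed
  then obtain n where n: "n > 0" and ne: "lamp_fold n (k, A) \<noteq> lamp_fold n (0, {})" by blast
  define F where "F f = lamp_fold n (lamp_decode f)" for f
  have fin: "finite (F ` carrier lamplighter)"
    by (rule finite_subset[of _ "{0..<n} \<times> Pow {0..<n}"])
      (use n in \<open>auto simp: F_def lamp_fold_def\<close>)
  have cong: "F (x \<otimes>\<^bsub>lamplighter\<^esub> y) = F (x' \<otimes>\<^bsub>lamplighter\<^esub> y')"
    if c: "x \<in> carrier lamplighter" "x' \<in> carrier lamplighter"
      "y \<in> carrier lamplighter" "y' \<in> carrier lamplighter" and e: "F x = F x'" "F y = F y'"
    for x x' y y'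
  proof -
    obtain k A k' A' l B l' B' where *:
      "x = lamp_code (k, A)" "x' = lamp_code (k', A')"
      "y = lamp_code (l, B)" "y' = lamp_code (l', B')" "finite A" "finite A'" "finite B" "finite B'"
      by (rule lamp_carrierE[OF c(1)], rule lamp_carrierE[OF c(2)], rule lamp_carrierE[OF c(3)],
          rule lamp_carrierE[OF c(4)]) (rule that)
    have "k mod n = k' mod n" "l mod n = l' mod n"
      "lamp_fold n (k, A) = lamp_fold n (k', A')" "lamp_fold n (l, B) = lamp_fold n (l', B')"
      using e by (auto simp: * F_def lamp_fold_def)
    then show ?thesis
      by (simp add: * F_def lamp_times lamp_fold_mult n)
  qed
  define N where "N = {x \<in> carrier lamplighter. F x = F \<one>\<^bsub>lamplighter\<^esub>}"
  have "N \<lhd> lamplighter" "finite (rcosets\<^bsub>lamplighter\<^esub> N)"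
    unfolding N_def by (rule finite_quotient_normal[OF group_lamplighter fin]; rule cong; assumption)+
  moreover have "g \<notin> N" using ne by (simp add: N_def F_def kA lamp_one)
  ultimately show "\<exists>N. N \<lhd> lamplighter \<and> finite (rcosets\<^bsub>lamplighter\<^esub> N) \<and> g \<notin> N" by blast
qed

section \<open>The action on the product of cube roots of unity\<close>

definition cube_roots :: "complex set" where
  "cube_roots = {z. z ^ 3 = 1}"

definition root_seqs :: "(nat \<Rightarrow> complex) set" where
  "root_seqs = {y. \<forall>n. y n \<in> cube_roots}"

definition root_group :: "(nat \<Rightarrow> complex) monoid" where
  "root_group = \<lparr>carrier = root_seqs, mult = (\<lambda>x y n. x n * y n), one = (\<lambda>n. 1)\<rparr>"

lemma root_group_simps [simp]:
  "carrier root_group = root_seqs"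
  "x \<otimes>\<^bsub>root_group\<^esub> y = (\<lambda>n. x n * y n)"
  "\<one>\<^bsub>root_group\<^esub> = (\<lambda>n. 1)"
  by (simp_all add: root_group_def)

lemma cube_roots_closed [simp]:
  "1 \<in> cube_roots"
  "z \<in> cube_roots \<Longrightarrow> w \<in> cube_roots \<Longrightarrow> z * w \<in> cube_roots"
  "z \<in> cube_roots \<Longrightarrow> inverse z \<in> cube_roots"
  by (simp_all add: cube_roots_def power_mult_distrib power_inverse)

lemma cube_roots_nonzero: "z \<in> cube_roots \<Longrightarrow> z \<noteq> 0"
  by (auto simp: cube_roots_def)

lemma finite_cube_roots: "finite cube_roots"
  unfolding cube_roots_def by (rule finite_roots_unity) simp

text \<open>Having a generator lets a homomorphism on cube roots be computed from a single value; it
  also supplies a nontrivial root.\<close>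

lemma cube_roots_generator:
  obtains w where "w \<in> cube_roots" "w \<noteq> 1" "\<And>z. z \<in> cube_roots \<Longrightarrow> \<exists>k. z = w ^ k"
proof -
  define f where "f k = cis (2 * pi * real k / real 3)" for k :: nat
  have bij: "bij_betw f {..<3} cube_roots"
    using Complex.bij_betw_roots_unity[of 3] by (simp add: f_def[abs_def] cube_roots_def)
  have pow: "f k = f 1 ^ k" for k
    unfolding f_def Complex.DeMoivre by (rule arg_cong[of _ _ cis]) simp
  show thesis
  proof (rule that[of "f 1"])
    show "f 1 \<in> cube_roots" using bij by (auto simp: bij_betw_def)
    have "f 1 \<noteq> f 0" using inj_onD[OF bij_betw_imp_inj_on[OF bij], of 1 0] by auto
    then show "f 1 \<noteq> 1" by (simp add: f_def)
    fix z assume "z \<in> cube_roots"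
    then obtain k where "z = f k" using bij by (auto simp: bij_betw_def)
    then show "\<exists>k. z = f 1 ^ k" using pow by blast
  qed
qed

lemma root_seqs_closed [simp]:
  "(\<lambda>n. 1) \<in> root_seqs"
  "x \<in> root_seqs \<Longrightarrow> y \<in> root_seqs \<Longrightarrow> (\<lambda>n. x n * y n) \<in> root_seqs"
  "x \<in> root_seqs \<Longrightarrow> (\<lambda>n. inverse (x n)) \<in> root_seqs"
  by (simp_all add: root_seqs_def)

lemma comm_group_root_group: "comm_group root_group"
proof (rule comm_groupI)
  fix x assume x: "x \<in> carrier root_group"
  then have "x n \<noteq> 0" for n by (simp add: root_seqs_def cube_roots_nonzero)
  with x show "\<exists>y\<in>carrier root_group. y \<otimes>\<^bsub>root_group\<^esub> x = \<one>\<^bsub>root_group\<^esub>"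
    by (intro bexI[of _ "\<lambda>n. inverse (x n)"]) simp_all
qed (simp_all add: mult_ac)

lemma root_group_inv: "x \<in> root_seqs \<Longrightarrow> inv\<^bsub>root_group\<^esub> x = (\<lambda>n. inverse (x n))"
  using comm_group_root_group
  by (intro group.inv_equality)
    (auto simp: comm_group_def root_seqs_def fun_eq_iff cube_roots_nonzero)

abbreviation root_top :: "(nat \<Rightarrow> complex) topology" where
  "root_top \<equiv> top_of_set root_seqs"

lemma compact_root_seqs: "compact root_seqs"
proof -
  have "compactin (product_topology (\<lambda>n::nat. euclidean :: complex topology) UNIV) (PiE UNIV (\<lambda>n. cube_roots))"
    by (simp add: compactin_PiE finite_imp_compact finite_cube_roots)
  moreover have "PiE UNIV (\<lambda>n. cube_roots) = root_seqs" by (auto simp: root_seqs_def)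
  ultimately show ?thesis by (simp add: euclidean_product_topology)
qed

lemma continuous_on_coordinate: "continuous_on S (\<lambda>y :: nat \<Rightarrow> complex. y n)"
  by (rule continuous_on_subset[OF continuous_on_product_coordinates]) simp

lemma compact_metrizable_root_group: "compact_metrizable_abelian_group root_group root_top"
  unfolding compact_metrizable_abelian_group_def
proof (intro conjI)
  show "comm_group root_group" by (rule comm_group_root_group)
  have "continuous_on (root_seqs \<times> root_seqs) (\<lambda>p n. fst p n * snd p n)"
    by (intro continuous_on_coordinatewise_then_product continuous_on_mult
          continuous_on_product_then_coordinatewise[OF continuous_on_fst[OF continuous_on_id]]
          continuous_on_product_then_coordinatewise[OF continuous_on_snd[OF continuous_on_id]])
  then show "continuous_map (prod_topology root_top root_top) root_top
      (\<lambda>(x, y). x \<otimes>\<^bsub>root_group\<^esub> y)"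
    by (auto simp: case_prod_unfold)
  have "continuous_on root_seqs (\<lambda>x n. inverse (x n))"
    by (intro continuous_on_coordinatewise_then_product continuous_on_inverse
          continuous_on_coordinate) (auto simp: root_seqs_def cube_roots_nonzero)
  then show "continuous_map root_top root_top (\<lambda>x. inv\<^bsub>root_group\<^esub> x)"
    by (auto simp: root_group_inv cong: continuous_on_cong)
  show "compact_space root_top" by (simp add: compact_space_subtopology compact_root_seqs)
  show "metrizable_space root_top"
    by (simp add: metrizable_space_subtopology metrizable_space_euclidean)
qed simp

text \<open>Coordinates are indexed by \<open>\<int>\<close> through \<^const>\<open>int_encode\<close>.  The lamplighter
  at position \<open>k\<close> shifts by \<open>k\<close>, and every lit lamp inverts the coordinate at its position.\<close>

definition lamp_move :: "int \<times> int set \<Rightarrow> (nat \<Rightarrow> complex) \<Rightarrow> nat \<Rightarrow> complex" where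
  "lamp_move x y = (\<lambda>n. let z = y (int_encode (int_decode n - fst x))
                     in if int_decode n \<in> snd x then inverse z else z)"

text \<open>The restriction makes each map extensional, as membership in \<open>Bij\<close>
  requires.\<close>

definition lamp_action :: "(nat \<Rightarrow> nat) \<Rightarrow> (nat \<Rightarrow> complex) \<Rightarrow> nat \<Rightarrow> complex" where
  "lamp_action g = (\<lambda>y \<in> root_seqs. lamp_move (lamp_decode g) y)"

lemma lamp_move_in [simp]: "y \<in> root_seqs \<Longrightarrow> lamp_move x y \<in> root_seqs"
  by (simp add: lamp_move_def root_seqs_def Let_def)

text \<open>A coordinate met by lamps of both factors is inverted twice, hence unchanged, in
  agreement with the symmetric difference in \<open>lamp_mult\<close>.\<close>

lemma lamp_move_mult: "lamp_move (lamp_mult x x') y = lamp_move x (lamp_move x' y)"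
  by (auto simp: lamp_move_def lamp_mult_def Let_def fun_eq_iff algebra_simps)

lemma lamp_move_one: "lamp_move (0, {}) y = y"
  by (simp add: lamp_move_def)

lemma lamp_action_code: "y \<in> root_seqs \<Longrightarrow> lamp_action (lamp_code x) y = lamp_move x y"
  by (simp add: lamp_action_def)

lemma lamp_action_in [simp]: "y \<in> root_seqs \<Longrightarrow> lamp_action g y \<in> root_seqs"
  by (simp add: lamp_action_def)

lemma group_action_lamp_action: "group_action lamplighter root_seqs lamp_action"
proof -
  interpret group lamplighter by (rule group_lamplighter)
  have mult: "lamp_action (g \<otimes>\<^bsub>lamplighter\<^esub> h) y = lamp_action g (lamp_action h y)"
    if "g \<in> carrier lamplighter" "h \<in> carrier lamplighter" "y \<in> root_seqs" for g h y
    using that by (elim lamp_carrierE) (simp add: lamp_times lamp_action_code lamp_move_mult)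
  have one: "lamp_action \<one>\<^bsub>lamplighter\<^esub> y = y" if "y \<in> root_seqs" for y
    using that by (simp add: lamp_one lamp_action_code lamp_move_one)
  have bij: "lamp_action g \<in> Bij root_seqs" if g: "g \<in> carrier lamplighter" for g
  proof -
    have "bij_betw (lamp_action g) root_seqs root_seqs"
      by (rule bij_betw_byWitness[where f' = "lamp_action (inv\<^bsub>lamplighter\<^esub> g)"])
        (use g in \<open>auto simp: mult[symmetric] one\<close>)
    then show ?thesis by (simp add: Bij_def lamp_action_def)
  qed
  have "lamp_action (g \<otimes>\<^bsub>lamplighter\<^esub> h) =
      lamp_action g \<otimes>\<^bsub>BijGroup root_seqs\<^esub> lamp_action h"
    if gh: "g \<in> carrier lamplighter" "h \<in> carrier lamplighter" for g h
  proof
    fix y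
    show "lamp_action (g \<otimes>\<^bsub>lamplighter\<^esub> h) y =
        (lamp_action g \<otimes>\<^bsub>BijGroup root_seqs\<^esub> lamp_action h) y"
      using mult[OF gh, of y] bij[OF gh(1)] bij[OF gh(2)]
      by (cases "y \<in> root_seqs") (simp_all add: BijGroup_def compose_def lamp_action_def)
  qed
  then have "lamp_action \<in> hom lamplighter (BijGroup root_seqs)"
    using bij by (auto simp: hom_def BijGroup_def)
  then show ?thesis
    unfolding group_action_def group_hom_def group_hom_axioms_def
    by (simp add: group_BijGroup group_lamplighter)
qed

lemma algebraic_lamp_action: "algebraic_action lamplighter root_group root_top lamp_action"
  unfolding algebraic_action_def
proof (intro conjI ballI)
  fix g assume "g \<in> carrier lamplighter"
  show "lamp_action g \<in> hom root_group root_group"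
    by (auto simp: hom_def) (auto simp: lamp_action_def lamp_move_def Let_def fun_eq_iff)
  have "continuous_on root_seqs (\<lambda>y. lamp_move (lamp_decode g) y)"
  proof (rule continuous_on_coordinatewise_then_product)
    fix n
    have nz: "y m \<noteq> 0" if "y \<in> root_seqs" for y m
      using that cube_roots_nonzero by (auto simp: root_seqs_def)
    show "continuous_on root_seqs (\<lambda>y. lamp_move (lamp_decode g) y n)"
      by (cases "int_decode n \<in> snd (lamp_decode g)")
        (auto simp: lamp_move_def Let_def nz
          intro!: continuous_on_coordinate continuous_on_inverse)
  qed
  then show "continuous_map root_top root_top (lamp_action g)"
    by (auto simp: lamp_action_def)
qed (simp_all add: group_lamplighter countable_lamplighter compact_metrizable_root_group
      group_action_lamp_action)

section \<open>Periodic points\<close>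

text \<open>A group of order 3 has no involutions. Hence a lamp changes every nontrivial coordinate
  that it meets.\<close>

lemma cube_root_eq_inverse:
  assumes "z \<in> cube_roots" "inverse z = z"
  shows "z = 1"
proof -
  have "z * z = 1" using right_inverse[OF cube_roots_nonzero[OF assms(1)]] assms(2) by simp
  then show ?thesis using assms(1) by (simp add: cube_roots_def power3_eq_cube)
qed

lemma periodic_points_lamp_action:
  "periodic_points lamplighter root_group lamp_action \<subseteq> {\<lambda>n. 1}"
proof
  fix y assume "y \<in> periodic_points lamplighter root_group lamp_action"
  then have y: "y \<in> root_seqs" and fin: "finite (orbit lamplighter lamp_action y)"
    by (auto simp: periodic_points_def)
  have orb: "lamp_move (k, A) y \<in> orbit lamplighter lamp_action y" if "finite A" for k A
    using that y unfolding orbit_def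
    by (auto simp: lamp_action_code intro!: exI[of _ "lamp_code (k, A)"])
  define u where "u i = y (int_encode i)" for i
  have u: "u i \<in> cube_roots" for i using y by (simp add: u_def root_seqs_def)
  have coord: "lamp_move (k, A) y (int_encode i) = (if i \<in> A then inverse (u (i - k)) else u (i - k))"
    for k A i by (simp add: lamp_move_def u_def Let_def)
  \<comment> \<open>A finite orbit cannot contain infinitely many distinct shifts of
    \<open>y\<close>, so two shifts agree and their difference is a period.\<close>
  have "\<not> inj (\<lambda>k. lamp_move (k, {}) y)"
  proof
    assume "inj (\<lambda>k. lamp_move (k, {}) y)"
    moreover have "finite (range (\<lambda>k. lamp_move (k, {}) y))"
      by (rule finite_subset[OF _ fin]) (use orb in auto)
    ultimately show False using finite_imageD infinite_UNIV_int by blast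
  qed
  then obtain k l where kl: "k \<noteq> l" "lamp_move (k, {}) y = lamp_move (l, {}) y"
    by (auto simp: inj_def)
  define p where "p = k - l"
  have per: "u (i + p) = u i" for i
    using fun_cong[OF kl(2), of "int_encode (i + k)"] by (simp add: coord p_def algebra_simps)
  have per': "u (i + int m * p) = u i" for i m
  proof (induction m)
    case (Suc m)
    then show ?case using per[of "i + int m * p"] by (simp add: algebra_simps)
  qed simp
  have "u i = 1" for i
  proof (rule ccontr)
    assume i: "u i \<noteq> 1"
    \<comment> \<open>By periodicity the coordinate at each \<open>i + int m * p\<close> equals
      \<open>u i\<close>, which is nontrivial. The point \<open>f m\<close> differs from
      \<open>y\<close> exactly there, so distinct \<open>m\<close> give distinct points of the
      orbit.\<close>
    define f where "f m = lamp_move (0, {i + int m * p}) y" for m :: nat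
    have "inj f"
    proof (rule injI, rule ccontr)
      fix m m' assume f: "f m = f m'" and "m \<noteq> m'"
      then have "i + int m * p \<noteq> i + int m' * p" using kl(1) by (simp add: p_def)
      then have "inverse (u i) = u i"
        using fun_cong[OF f, of "int_encode (i + int m * p)"] by (simp add: f_def coord per')
      then show False using cube_root_eq_inverse[OF u[of i]] i by simp
    qed
    moreover have "finite (range f)"
      by (rule finite_subset[OF _ fin]) (use orb in \<open>auto simp: f_def\<close>)
    ultimately show False using finite_imageD infinite_UNIV_nat by blast
  qed
  then have "y n = 1" for n
    by (metis int_decode_inverse u_def)
  then show "y \<in> {\<lambda>n. 1}" by auto
qed

lemma periodic_points_not_dense:
  "root_top closure_of (periodic_points lamplighter root_group lamp_action) \<noteq> topspace root_top"
proof
  assume dense: "root_top closure_of (periodic_points lamplighter root_group lamp_action) = topspace root_top"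
  have "closedin root_top {\<lambda>n. 1}"
    by (auto simp: closed_subset)
  then have "root_seqs \<subseteq> {\<lambda>n. 1}"
    using closure_of_minimal[OF periodic_points_lamp_action, of root_top] dense by simp
  moreover obtain w where "w \<in> cube_roots" "w \<noteq> 1" by (rule cube_roots_generator)
  then have "(\<lambda>n. w) \<in> root_seqs" "(\<lambda>n :: nat. w) \<noteq> (\<lambda>n. 1)"
    by (auto simp: root_seqs_def fun_eq_iff)
  ultimately show False by blast
qed

section \<open>Simplicity of the dual module\<close>

context
  fixes \<phi> assumes char: "\<phi> \<in> characters root_group root_top"
begin

lemma character_mult:
  "x \<in> root_seqs \<Longrightarrow> y \<in> root_seqs \<Longrightarrow> \<phi> (\<lambda>n. x n * y n) = \<phi> x * \<phi> y"
  using char by (auto simp: characters_def hom_def circle_group_def)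

lemma character_nonzero: "y \<in> root_seqs \<Longrightarrow> \<phi> y \<noteq> 0"
  using char by (auto simp: characters_def hom_def circle_group_def Pi_iff)

lemma character_one: "\<phi> (\<lambda>n. 1) = 1"
  using character_mult[of "\<lambda>n. 1" "\<lambda>n. 1"] character_nonzero[of "\<lambda>n. 1"] by simp

text \<open>Every element of the group has cube 1, and \<open>\<phi>\<close> preserves this. The
  values of \<open>\<phi>\<close> thus lie in a finite, discrete set.\<close>

lemma character_in_cube_roots: "y \<in> root_seqs \<Longrightarrow> \<phi> y \<in> cube_roots"
proof -
  assume y: "y \<in> root_seqs"
  then have "(\<lambda>n. y n * (y n * y n)) = (\<lambda>n. 1)"
    by (auto simp: root_seqs_def cube_roots_def power3_eq_cube mult.assoc)
  then have "\<phi> y * (\<phi> y * \<phi> y) = 1"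
    using y character_mult[of y "\<lambda>n. y n * y n"] character_mult[of y y] character_one by simp
  then show ?thesis by (simp add: cube_roots_def power3_eq_cube mult.assoc)
qed

text \<open>The circle has no small subgroups: \<open>\<phi>\<close> maps a neighbourhood of the identity into a
  neighbourhood of \<open>1\<close> that contains no other cube root of unity.\<close>

lemma character_finite_support:
  obtains F where "finite F"
    "\<And>y. y \<in> root_seqs \<Longrightarrow> (\<And>n. n \<in> F \<Longrightarrow> y n = 1) \<Longrightarrow> \<phi> y = 1"
proof -
  define V where "V = - (cube_roots - {1})"
  have "open V" unfolding V_def
    by (intro open_Compl finite_imp_closed) (simp add: finite_cube_roots)
  moreover have "continuous_on root_seqs \<phi>" using char by (simp add: characters_def)
  ultimately have "openin root_top (root_seqs \<inter> \<phi> -` V)"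
    by (rule continuous_openin_preimage_gen[rotated])
  then obtain U where U: "open U" "root_seqs \<inter> \<phi> -` V = root_seqs \<inter> U"
    by (auto simp: openin_open)
  have one: "(\<lambda>n. 1) \<in> U"
    using U(2) character_one by (auto simp: V_def set_eq_iff dest!: spec[of _ "\<lambda>n. 1"])
  \<comment> \<open>A basic neighbourhood in the product topology constrains only finitely many
    coordinates; these form the required set \<open>F\<close>.\<close>
  have "openin (product_topology (\<lambda>n::nat. euclidean :: complex topology) UNIV) U"
    using U(1) by (simp add: euclidean_product_topology)
  from product_topology_open_contains_basis[OF this one]
  obtain X where X: "(\<lambda>n. 1) \<in> PiE UNIV X" "finite {n. X n \<noteq> UNIV}" "PiE UNIV X \<subseteq> U"
    by auto
  show thesis
  proof (rule that[OF X(2)])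
    fix y assume y: "y \<in> root_seqs" "\<And>n. n \<in> {n. X n \<noteq> UNIV} \<Longrightarrow> y n = 1"
    have "y n \<in> X n" for n using X(1) y(2)[of n] by (cases "X n = UNIV") auto
    then have "y \<in> U" using X(3) by auto
    then have "\<phi> y \<in> V" using U(2) y(1) by blast
    then show "\<phi> y = 1" using character_in_cube_roots[OF y(1)] by (simp add: V_def)
  qed
qed

text \<open>On one coordinate \<open>\<phi>\<close> is determined by its value at a generator
  \<open>w\<close>. That value is again a cube root of unity, so it is some \<open>w ^ k\<close>,
  and the same \<open>k\<close> serves all powers of \<open>w\<close>.\<close>

lemma character_coordinate:
  obtains k :: nat where "\<And>c. c \<in> cube_roots \<Longrightarrow> \<phi> (\<lambda>m. if m = n then c else 1) = c ^ k"
proof -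
  obtain w where w: "w \<in> cube_roots" "\<And>z. z \<in> cube_roots \<Longrightarrow> \<exists>k. z = w ^ k"
    by (rule cube_roots_generator) blast
  define e where "e c = (\<lambda>m. if m = n then c else 1 :: complex)" for c
  have e: "e c \<in> root_seqs" if "c \<in> cube_roots" for c using that by (simp add: e_def root_seqs_def)
  obtain k where k: "\<phi> (e w) = w ^ k" using w(2) character_in_cube_roots[OF e[OF w(1)]] by blast
  have pow: "w ^ j \<in> cube_roots \<and> \<phi> (e (w ^ j)) = (w ^ k) ^ j" for j
  proof (induction j)
    case 0
    show ?case using character_one by (simp add: e_def)
  next
    case (Suc j)
    have "e (w ^ Suc j) = (\<lambda>m. e w m * e (w ^ j) m)" by (auto simp: e_def)
    then show ?case using Suc w(1) k character_mult[OF e e] by simp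
  qed
  have "\<phi> (e c) = c ^ k" if c: "c \<in> cube_roots" for c
    using w(2)[OF c] pow by (auto simp: power_mult[symmetric] mult.commute)
  then show thesis by (rule that[unfolded e_def[symmetric]])
qed

text \<open>Split \<open>y\<close> into its part on the finite support and the rest, where
  \<open>\<phi>\<close> is 1; the finite part is a product of one-coordinate elements. The last
  conclusion ties each exponent back to \<open>\<phi>\<close>, so that the effect of a single lamp
  can be read off.\<close>

lemma character_prod:
  obtains F m where "finite F" "\<And>y. y \<in> root_seqs \<Longrightarrow> \<phi> y = (\<Prod>n\<in>F. y n ^ m n)"
    "\<And>n c. n \<in> F \<Longrightarrow> c \<in> cube_roots \<Longrightarrow> \<phi> (\<lambda>j. if j = n then c else 1) = c ^ m n"
proof -
  obtain F where F: "finite F" "\<And>y. y \<in> root_seqs \<Longrightarrow> (\<And>n. n \<in> F \<Longrightarrow> y n = 1) \<Longrightarrow> \<phi> y = 1"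
    by (rule character_finite_support) blast
  have "\<forall>n. \<exists>k. \<forall>c \<in> cube_roots. \<phi> (\<lambda>j. if j = n then c else 1) = c ^ k"
    using character_coordinate by metis
  then obtain m where m: "\<And>n c. c \<in> cube_roots \<Longrightarrow> \<phi> (\<lambda>j. if j = n then c else 1) = c ^ m n"
    by metis
  have trunc: "\<phi> (\<lambda>j. if j \<in> E then y j else 1) = (\<Prod>n\<in>E. y n ^ m n)"
    if y: "y \<in> root_seqs" and "finite E" for y E
    using \<open>finite E\<close>
  proof induction
    case empty
    show ?case using character_one by simp
  next
    case (insert n E)
    have "(\<lambda>j. if j \<in> insert n E then y j else 1) =
        (\<lambda>j. (if j = n then y n else 1) * (if j \<in> E then y j else 1))"
      using insert.hyps by auto
    moreover have "(\<lambda>j. if j = n then y n else 1) \<in> root_seqs" "(\<lambda>j. if j \<in> E then y j else 1) \<in> root_seqs"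
      using y by (auto simp: root_seqs_def)
    moreover have "\<phi> (\<lambda>j. if j = n then y n else 1) = y n ^ m n"
      using y by (intro m) (simp add: root_seqs_def)
    ultimately show ?case using insert character_mult by simp
  qed
  have "\<phi> y = (\<Prod>n\<in>F. y n ^ m n)" if y: "y \<in> root_seqs" for y
  proof -
    have eq: "y = (\<lambda>j. (if j \<in> F then y j else 1) * (if j \<in> F then 1 else y j))"
      by auto
    have in': "(\<lambda>j. if j \<in> F then y j else 1) \<in> root_seqs" "(\<lambda>j. if j \<in> F then 1 else y j) \<in> root_seqs"
      using y by (auto simp: root_seqs_def)
    have "\<phi> y = \<phi> (\<lambda>j. if j \<in> F then y j else 1) * \<phi> (\<lambda>j. if j \<in> F then 1 else y j)"
      by (subst eq) (rule character_mult[OF in'])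
    also have "\<phi> (\<lambda>j. if j \<in> F then 1 else y j) = 1"
      using in'(2) by (rule F(2)) simp
    finally show ?thesis using trunc[OF y F(1)] by simp
  qed
  with F(1) m show thesis using that by blast
qed

end

abbreviation lamp_dual :: "((nat \<Rightarrow> nat) \<Rightarrow> int, (nat \<Rightarrow> complex) \<Rightarrow> complex) module" where
  "lamp_dual \<equiv> dual_module lamplighter root_group root_top lamp_action"

section \<open>Submodules of the dual\<close>

context
  fixes K assumes K: "submodule K (int_group_ring lamplighter) lamp_dual"
begin

lemma submodule_trivial: "(\<lambda>y \<in> root_seqs. 1) \<in> K"
  using subgroup.one_closed[OF submodule.axioms(1)[OF K]] by (simp add: dual_module_def)

lemma submodule_mult:
  "\<phi> \<in> K \<Longrightarrow> \<psi> \<in> K \<Longrightarrow> (\<lambda>y \<in> root_seqs. \<phi> y * \<psi> y) \<in> K"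
  using subgroup.m_closed[OF submodule.axioms(1)[OF K]] by (simp add: dual_module_def)

lemma submodule_characters: "K \<subseteq> characters root_group root_top"
  using subgroup.subset[OF submodule.axioms(1)[OF K]] by (simp add: dual_module_def)

lemma submodule_translate:
  assumes "\<phi> \<in> K" "finite A"
  shows "(\<lambda>y \<in> root_seqs. \<phi> (lamp_move (k, A) y) powi a) \<in> K"
proof -
  interpret group lamplighter by (rule group_lamplighter)
  \<comment> \<open>The dual action composes with the inverse group element, so the scalar is
    \<open>a\<close> times the inverse of the desired move.\<close>
  define h where "h = inv\<^bsub>lamplighter\<^esub> (lamp_code (k, A))"
  have h: "h \<in> carrier lamplighter" and inv_h: "inv\<^bsub>lamplighter\<^esub> h = lamp_code (k, A)"
    using assms(2) by (simp_all add: h_def)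
  define r where "r = (\<lambda>g. if g = h then a else 0)"
  \<comment> \<open>For \<open>a = 0\<close> the support is empty, and the empty product agrees with
    the zeroth power.\<close>
  have supp: "group_ring_supp lamplighter r = (if a = 0 then {} else {h})"
    using h by (auto simp: group_ring_supp_def r_def)
  then have "r \<in> carrier (int_group_ring lamplighter)"
    using h by (auto simp: int_group_ring_def r_def)
  then have "r \<odot>\<^bsub>lamp_dual\<^esub> \<phi> \<in> K" using submodule.smult_closed[OF K] assms(1) by blast
  moreover have "(\<Prod>g \<in> group_ring_supp lamplighter r. \<phi> (lamp_action (inv\<^bsub>lamplighter\<^esub> g) y) powi r g) =
      \<phi> (lamp_move (k, A) y) powi a" if "y \<in> root_seqs" for y
    using that by (simp add: supp inv_h lamp_action_code) (simp add: r_def)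
  then have "r \<odot>\<^bsub>lamp_dual\<^esub> \<phi> = (\<lambda>y \<in> root_seqs. \<phi> (lamp_move (k, A) y) powi a)"
    by (auto simp: dual_module_def)
  ultimately show ?thesis by simp
qed

lemma submodule_power:
  assumes "\<phi> \<in> K"
  shows "(\<lambda>y \<in> root_seqs. \<phi> y powi a) \<in> K"
  using submodule_translate[OF assms, of "{}" 0 a] by (simp add: lamp_move_one)

text \<open>Dividing the translate of \<open>\<phi>\<close> by one lamp through \<open>\<phi>\<close> isolates the dependence on one
  coordinate, because \<open>z\<^sup>-\<^sup>1 = z\<^sup>2\<close> for cube roots of unity.\<close>

lemma submodule_contains_coordinates:
  assumes \<phi>: "\<phi> \<in> K" and ne: "\<phi> \<noteq> (\<lambda>y \<in> root_seqs. 1)"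
  shows "(\<lambda>y \<in> root_seqs. y j) \<in> K"
proof -
  have char: "\<phi> \<in> characters root_group root_top" using \<phi> submodule_characters by blast
  obtain F m where F: "finite F" "\<And>y. y \<in> root_seqs \<Longrightarrow> \<phi> y = (\<Prod>n\<in>F. y n ^ m n)"
    and m: "\<And>n c. n \<in> F \<Longrightarrow> c \<in> cube_roots \<Longrightarrow> \<phi> (\<lambda>j. if j = n then c else 1) = c ^ m n"
    by (rule character_prod[OF char]) blast
  have cube: "z ^ (3 * q) = 1" if "z \<in> cube_roots" for z q
    using that by (simp add: power_mult cube_roots_def)
  \<comment> \<open>Exponents matter only modulo 3; if all of them were divisible by 3,
    \<open>\<phi>\<close> would be trivial.\<close>
  have "\<exists>n\<in>F. \<not> 3 dvd m n"
  proof (rule ccontr)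
    assume "\<not> ?thesis"
    then have "\<phi> y = 1" if "y \<in> root_seqs" for y
      using that F(2)[OF that] by (auto simp: root_seqs_def dvd_def cube intro!: prod.neutral)
    moreover have "\<phi> \<in> extensional root_seqs" using char by (simp add: characters_def)
    ultimately have "\<phi> = (\<lambda>y \<in> root_seqs. 1)" by (auto simp: extensional_def)
    with ne show False by simp
  qed
  then obtain n where n: "n \<in> F" "\<not> 3 dvd m n" by blast
  have lamp: "\<phi> (lamp_move (0, {int_decode n}) y) * inverse (\<phi> y) = y n ^ m n"
    if y: "y \<in> root_seqs" for y
  proof -
    have yn: "y n \<in> cube_roots" using y by (simp add: root_seqs_def)
    then have "inverse (y n) = y n * y n"
      by (intro inverse_unique) (simp add: cube_roots_def power3_eq_cube mult.assoc)
    then have "lamp_move (0, {int_decode n}) y = (\<lambda>j. y j * (if j = n then y n else 1))"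
      by (auto simp: lamp_move_def Let_def fun_eq_iff dest: injD[OF inj_int_decode])
    moreover have "(\<lambda>j. if j = n then y n else 1) \<in> root_seqs" using yn by (auto simp: root_seqs_def)
    ultimately have "\<phi> (lamp_move (0, {int_decode n}) y) = \<phi> y * y n ^ m n"
      using character_mult[OF char y] m[OF n(1) yn] by simp
    then show ?thesis using character_nonzero[OF char y] by simp
  qed
  have "(\<lambda>y \<in> root_seqs. y n ^ m n) \<in> K"
    using submodule_mult[OF submodule_translate[OF \<phi>, of "{int_decode n}" 0 1] submodule_power[OF \<phi>, of "- 1"]]
    by (simp add: lamp cong: restrict_cong)
  from submodule_power[OF this, of "int (m n)"]
  have "(\<lambda>y \<in> root_seqs. y n ^ (m n * m n)) \<in> K"
    by (simp add: power_mult cong: restrict_cong)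
  \<comment> \<open>An exponent prime to 3 is its own inverse modulo 3. Raising to the power
    \<open>m n\<close> once more therefore leaves the coordinate itself.\<close>
  moreover have "\<exists>q. m n * m n = Suc (3 * q)"
  proof -
    have "m n mod 3 = 1 \<or> m n mod 3 = 2" using n(2) by presburger
    then have "(m n * m n) mod 3 = 1" by (auto simp: mod_mult_eq[of "m n" 3 "m n", symmetric])
    then show ?thesis by presburger
  qed
  then obtain q where "m n * m n = Suc (3 * q)" by blast
  ultimately have "(\<lambda>y \<in> root_seqs. y n) \<in> K"
    by (simp add: cube root_seqs_def cong: restrict_cong)
  \<comment> \<open>After a shift by \<open>k\<close>, coordinate \<open>n\<close> reads the old
    coordinate at position \<open>int_decode n - k\<close>; this \<open>k\<close> makes it the
    coordinate \<open>j\<close>.\<close>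
  note submodule_translate[OF this finite.emptyI, of "int_decode n - int_decode j" 1]
  moreover have "(\<lambda>y \<in> root_seqs. (\<lambda>y \<in> root_seqs. y n)
      (lamp_move (int_decode n - int_decode j, {}) y) powi 1) = (\<lambda>y \<in> root_seqs. y j)"
    by (rule restrict_ext) (simp, simp add: lamp_move_def)
  ultimately show ?thesis by (simp only:)
qed

text \<open>One nontrivial element yields all coordinate characters, and by
  \<open>character_prod\<close> every character is a finite product of their powers.\<close>

lemma submodule_eq_characters:
  assumes "\<phi> \<in> K" "\<phi> \<noteq> (\<lambda>y \<in> root_seqs. 1)"
  shows "K = characters root_group root_top"
proof
  show "K \<subseteq> characters root_group root_top" by (rule submodule_characters)
  show "characters root_group root_top \<subseteq> K"
  proof
    fix \<psi> assume \<psi>: "\<psi> \<in> characters root_group root_top"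
    obtain F m where F: "finite F" "\<And>y. y \<in> root_seqs \<Longrightarrow> \<psi> y = (\<Prod>n\<in>F. y n ^ m n)"
      by (rule character_prod[OF \<psi>]) blast
    have "(\<lambda>y \<in> root_seqs. \<Prod>n\<in>F. y n ^ m n) \<in> K"
      using F(1)
    proof induction
      case empty
      show ?case using submodule_trivial by (simp only: prod.empty)
    next
      case (insert n F)
      have "(\<lambda>y \<in> root_seqs. y n ^ m n) \<in> K"
        using submodule_power[OF submodule_contains_coordinates[OF assms, of n], of "int (m n)"]
        by (simp cong: restrict_cong)
      note submodule_mult[OF this insert.IH]
      moreover have "(\<lambda>y \<in> root_seqs. (\<lambda>y \<in> root_seqs. y n ^ m n) y * (\<lambda>y \<in> root_seqs. \<Prod>n\<in>F. y n ^ m n) y) =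
          (\<lambda>y \<in> root_seqs. \<Prod>n\<in>insert n F. y n ^ m n)"
        by (rule restrict_ext) (simp add: insert.hyps)
      ultimately show ?case by (simp only:)
    qed
    moreover have "\<psi> \<in> extensional root_seqs" using \<psi> by (simp add: characters_def)
    then have "\<psi> = (\<lambda>y \<in> root_seqs. \<Prod>n\<in>F. y n ^ m n)"
      using F(2) by (intro extensionalityI[of _ root_seqs]) simp_all
    ultimately show "\<psi> \<in> K" by simp
  qed
qed

end

text \<open>By simplicity, a submodule is generated by the empty set if it is trivial, and by any
  one of its nontrivial characters otherwise.\<close>

lemma noetherian_lamp_action: "noetherian_action lamplighter root_group root_top lamp_action"
  unfolding noetherian_action_def noetherian_module_def
proof (intro conjI allI impI)
  let ?R = "int_group_ring lamplighter"
  fix H assume H: "submodule H ?R lamp_dual"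
  show "\<exists>A\<subseteq>H. finite A \<and> H = \<Inter> {K. submodule K ?R lamp_dual \<and> A \<subseteq> K}"
  proof (cases "H \<subseteq> {\<lambda>y \<in> root_seqs. 1}")
    case True
    \<comment> \<open>The trivial submodule lies in every submodule and is one itself, so it is the
      intersection of all of them.\<close>
    then have "H \<subseteq> K" if "submodule K ?R lamp_dual" for K
      using submodule_trivial[OF that] by blast
    with H show ?thesis by (intro exI[of _ "{}"]) blast
  next
    case False
    then obtain \<phi> where \<phi>: "\<phi> \<in> H" "\<phi> \<noteq> (\<lambda>y \<in> root_seqs. 1)" by blast
    then have "K = H" if "submodule K ?R lamp_dual" "{\<phi>} \<subseteq> K" for K
      using submodule_eq_characters[OF that(1) _ \<phi>(2)] submodule_eq_characters[OF H \<phi>] that(2) by simp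
    then have "{K. submodule K ?R lamp_dual \<and> {\<phi>} \<subseteq> K} = {H}" using H \<phi> by blast
    then show ?thesis using \<phi>(1) by (intro exI[of _ "{\<phi>}"]) simp
  qed
qed (rule algebraic_lamp_action)

(* HOL cannot quantify over types, so the carriers live in fixed types that lose no generality:
   by Cayley's theorem every countable group is isomorphic to one with elements nat => nat, and
   every compact metrizable abelian group embeds topologically in a countable power of the
   circle. The group operations and the topology T are arbitrary. *)
theorem mainTheorem2:
  shows "\<exists>(\<Gamma> :: (nat \<Rightarrow> nat) monoid) (Y :: (nat \<Rightarrow> complex) monoid)
            (T :: (nat \<Rightarrow> complex) topology) (\<beta> :: (nat \<Rightarrow> nat) \<Rightarrow> (nat \<Rightarrow> complex) \<Rightarrow> (nat \<Rightarrow> complex)).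
           finitely_generated_group \<Gamma> \<and> residually_finite_group \<Gamma> \<and>
           noetherian_action \<Gamma> Y T \<beta> \<and>
           T closure_of (periodic_points \<Gamma> Y \<beta>) \<noteq> topspace T"
  by (rule exI[of _ lamplighter], rule exI[of _ root_group], rule exI[of _ root_top],
      rule exI[of _ lamp_action])
    (intro conjI finitely_generated_lamplighter residually_finite_lamplighter
      noetherian_lamp_action periodic_points_not_dense)

end
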